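(* For every integer $m\ge1$ and every $\beta\in\mathbb{C}$ with $\mathfrak{Re}(\beta)>0$, $$I_{1^-}^m\left[(1-x)^{\beta-1}\log\Gamma(x)\right](0)=\int_{0}^{1}\int_{t_1}^{1}\cdots\int_{t_{m-1}}^{1}(1-t_m)^{\beta-1}\log\Gamma(t_m)\,dt_m\cdots dt_2\,dt_1=\sum_{n=0}^{\infty}(-1)^n(m+n-1)\cdots m\,\binom{\beta-1}{n}\,I_{1^-}^{n+m}\log\Gamma(0),$$ where the empty product $(m+n-1)\cdots m$ when $n=0$ is taken to be $1$.
   Context: $\Gamma$ is Euler's gamma function and $\log\Gamma(t)$ is the real logarithm for $t\in(0,1]$. For $\mathfrak{Re}(\alpha)>0$ the right-sided Riemann-Liouville fractional integral of order $\alpha$ of $f$ on $[a,b]$ is $I_{b^-}^\alpha f(x)=\frac{1}{\Gamma(\alpha)}\int_x^b (t-x)^{\alpha-1}f(t)\,dt$ ($a\le x<b$). Here $a=0$, $b=1$ (and the same formula is used for complex-valued $f$ on $(0,1)$), so for an integer $j\ge1$, $I_{1^-}^j[f(x)](0)=\frac{1}{(j-1)!}\int_0^1 t^{j-1}f(t)\,dt$ and $I_{1^-}^{j}\log\Gamma(0)=\frac{1}{(j-1)!}\int_0^1 t^{j-1}\log\Gamma(t)\,dt$. For positive real $y$ and complex $s$, $y^s=e^{s\log y}$. The generalized binomial coefficient is $\binom{\beta-1}{n}=\frac{(\beta-1)(\beta-2)\cdots(\beta-n)}{n!}$, equal to $1$ for $n=0$. The product $(m+n-1)\cdots m$ is $\frac{(m+n-1)!}{(m-1)!}$.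 For $m=1$ the repeated integral is $\int_0^1 (1-t_1)^{\beta-1}\log\Gamma(t_1)\,dt_1$. *)

theory Defs
  imports "HOL-Analysis.Analysis"
begin

definition rl_right_integral :: "real \<Rightarrow> complex \<Rightarrow> (real \<Rightarrow> complex) \<Rightarrow> real \<Rightarrow> complex" where
  "rl_right_integral b \<alpha> f x =
     1 / Gamma \<alpha> * (LBINT t:{x<..<b}. of_real (t - x) powr (\<alpha> - 1) * f t)"

definition log_Gamma :: "real \<Rightarrow> complex" where
  "log_Gamma t = of_real (ln (Gamma t))"

(* For m >= 1, iterated_integral b f m x is the m-fold integral of f(t_m) dt_m ... dt_1 with
   x < t_1 < b, t_1 < t_2 < b, ..., t_{m-1} < t_m < b; the recursion peels off the outermost
   variable t_1. *)
primrec iterated_integral :: "real \<Rightarrow> (real \<Rightarrow> complex) \<Rightarrow> nat \<Rightarrow> real \<Rightarrow> complex" where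
  "iterated_integral b f 0 x = f x"
| "iterated_integral b f (Suc k) x = (LBINT t:{x<..<b}. iterated_integral b f k t)"

end

theory Submission
  imports Defs "HOL-Real_Asymp.Real_Asymp"
begin

text \<open>
  Two classical facts combine here. Repeatedly exchanging the order of integration
  turns the \<open>m\<close>-fold integral into a single one with the Cauchy kernel
  \<open>(t - x) ^ (m - 1) / (m - 1)!\<close> (\<open>iterated_integral_eq_Cauchy_kernel\<close>), and at integer order this
  is the Riemann--Liouville integral (\<open>rl_right_integral_of_nat\<close>). For the series, the binomial
  theorem expands \<open>(1 - t) powr (\<beta> - 1)\<close> in powers of \<open>-t\<close>, and integration term by term against
  \<open>t ^ (m - 1) * log_Gamma t\<close> yields the moments of \<open>log_Gamma\<close>, because
  \<open>(m + n - 1) \<cdots> m / (m + n - 1)! = 1 / (m - 1)!\<close>.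

  Only the exchange of sum and integral needs estimates. On \<open>(0,1)\<close> log-convexity of the Gamma
  function gives \<open>0 \<le> ln (Gamma t) \<le> - ln t\<close>, so the \<open>j\<close>-th absolute moment is at most
  \<open>1 / (j + 1)\<^sup>2\<close> (\<open>log_Gamma_moments\<close>). The binomial coefficients grow at most like
  \<open>n powr - Re \<beta>\<close>, hence are bounded (\<open>gbinomial_bounded\<close>), and the norms of the terms have
  summable integrals. This dominated summation also supplies the integrability of
  \<open>(1 - t) powr (\<beta> - 1) * log_Gamma t\<close>, which the Fubini argument requires
  (\<open>binomial_log_Gamma_series\<close>).
\<close>

section \<open>Moments of log Gamma on the unit interval\<close>

text \<open>
  Convexity of \<open>ln \<circ> Gamma\<close> together with its zeros at 1 and 2: the function is nonpositive between
  the zeros and nonnegative to the left of them. The upper bound on \<open>(0,1)\<close> comes from the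
  nonpositivity at \<open>1 + t\<close> through \<open>Gamma (1 + t) = t * Gamma t\<close>.
\<close>

lemma ln_Gamma_unit_interval_bounds:
  fixes t :: real
  assumes "0 < t" "t < 1"
  shows "0 \<le> ln (Gamma t)" and "ln (Gamma t) \<le> - ln t"
proof -
  let ?g = "ln \<circ> (Gamma :: real \<Rightarrow> real)"
  have Gamma_2: "Gamma 2 = (1 :: real)"
    using Gamma_fact[of 1, where ?'a = real] by simp
  have convex: "?g ((1 - u) * x + u * y) \<le> (1 - u) * ?g x + u * ?g y"
    if "0 \<le> u" "u \<le> 1" "0 < x" "0 < y" for u x y :: real
    using convex_onD[OF log_convex_Gamma_real, of u x y] that by simp
  \<comment> \<open>The point 1 lies between t and 2 with weights 1 / (2 - t) and (1 - t) / (2 - t).\<close>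
  have "(1 - (1 - t) / (2 - t)) * t + ((1 - t) / (2 - t)) * 2 = 1"
    using assms by (simp add: divide_simps)
  moreover have "1 - (1 - t) / (2 - t) = 1 / (2 - t)"
    using assms by (simp add: divide_simps)
  ultimately have "0 \<le> (1 / (2 - t)) * ln (Gamma t)"
    using convex[of "(1 - t) / (2 - t)" t 2] assms by (simp add: Gamma_2)
  then show "0 \<le> ln (Gamma t)"
    using assms by (simp add: zero_le_divide_iff)
  have "ln (Gamma (1 + t)) \<le> 0"
    using convex[of t 1 2] assms by (simp add: Gamma_2 algebra_simps)
  moreover have "t \<notin> \<int>\<^sub>\<le>\<^sub>0"
    using assms by (auto elim!: nonpos_Ints_cases')
  then have "Gamma (1 + t) = t * Gamma t"
    using Gamma_plus1[of t] by (simp add: add.commute)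
  moreover have "Gamma t \<noteq> 0"
    using Gamma_real_pos[of t] assms by linarith
  ultimately show "ln (Gamma t) \<le> - ln t"
    using assms \<open>Gamma t \<noteq> 0\<close> by (simp add: ln_mult)
qed

lemma power_times_neg_ln_integral:
  fixes k :: nat
  shows "set_integrable lborel {0<..<1} (\<lambda>t::real. t ^ k * (- ln t))" (is ?integrable)
    and "(LBINT t:{0<..<1}. t ^ k * (- ln t)) = 1 / (real k + 1)\<^sup>2" (is ?integral)
proof -
  let ?F = "\<lambda>t::real. t ^ (k + 1) / (real k + 1)\<^sup>2 - t ^ (k + 1) * ln t / (real k + 1)"
  have derivative: "DERIV ?F x :> x ^ k * (- ln x)" if "0 < x" for x :: real
  proof -
    have power: "DERIV (\<lambda>t. t ^ (k + 1)) x :> (real k + 1) * x ^ k"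
      using DERIV_pow[of "k + 1" x] by (simp add: add.commute)
    have "DERIV ?F x :> (real k + 1) * x ^ k / (real k + 1)\<^sup>2
            - ((real k + 1) * x ^ k * ln x + 1 / x * x ^ (k + 1)) / (real k + 1)"
      by (intro DERIV_diff DERIV_cdivide DERIV_mult power DERIV_ln_divide that)
    also have "(real k + 1) * x ^ k / (real k + 1)\<^sup>2
            - ((real k + 1) * x ^ k * ln x + 1 / x * x ^ (k + 1)) / (real k + 1) = x ^ k * (- ln x)"
    proof -
      have "K * p / K\<^sup>2 - (K * p * l + 1 / x * (p * x)) / K = p * (- l)" if "K > 0" for K p l
        using that \<open>0 < x\<close> by (simp add: add_divide_distrib power2_eq_square)
      from this[of "real k + 1" "x ^ k" "ln x"] show ?thesis
        by (simp add: mult_ac)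
    qed
    finally show ?thesis .
  qed
  \<comment> \<open>One factor t tames the logarithm, which leaves a limit free of the exponent k.\<close>
  have "((\<lambda>t::real. t * ln t) \<longlongrightarrow> 0) (at_right 0)"
    by real_asymp
  then have "((\<lambda>t::real. t ^ k * (t * ln t)) \<longlongrightarrow> 0 ^ k * 0) (at_right 0)"
    by (intro tendsto_intros)
  then have power_ln: "((\<lambda>t::real. t ^ (k + 1) * ln t) \<longlongrightarrow> 0) (at_right 0)"
    by (simp add: mult_ac)
  have "(?F \<longlongrightarrow> 0 ^ (k + 1) / (real k + 1)\<^sup>2 - 0 / (real k + 1)) (at_right 0)"
    by (intro tendsto_diff tendsto_divide tendsto_power tendsto_ident_at tendsto_const power_ln) auto
  then have "(?F \<longlongrightarrow> 0) (at_right 0)"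
    by simp
  then have at_0: "((?F \<circ> real_of_ereal) \<longlongrightarrow> 0) (at_right 0)"
    unfolding zero_ereal_def by (rule ereal_tendsto_simps1(2)[THEN iffD2])
  have at_1: "((?F \<circ> real_of_ereal) \<longlongrightarrow> 1 / (real k + 1)\<^sup>2) (at_left 1)"
    unfolding one_ereal_def by (rule ereal_tendsto_simps1(1)[THEN iffD2])
      (auto intro!: tendsto_eq_intros)
  have continuous: "isCont (\<lambda>t. t ^ k * (- ln t)) x" if "0 < ereal x" for x
    using that by (auto intro!: continuous_intros)
  have nonneg: "AE x in lborel. 0 < ereal x \<longrightarrow> ereal x < 1 \<longrightarrow> 0 \<le> x ^ k * (- ln x)"
    by (intro AE_I2) (auto intro!: mult_nonneg_nonpos)
  note FTC = interval_integral_FTC_nonneg[where a = 0 and b = 1 and F = ?F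
      and f = "\<lambda>t. t ^ k * (- ln t)", OF _ _ _ nonneg at_0 at_1]
  have interval: "einterval 0 1 = {0<..<1}"
    by (auto simp: einterval_def)
  show ?integrable
    using FTC(1) derivative continuous by (simp add: interval del: mult_minus_right)
  show ?integral
    using FTC(2) derivative continuous
    by (simp add: interval_lebesgue_integral_def interval del: mult_minus_right)
qed

lemma log_Gamma_moments:
  fixes k :: nat
  shows "set_integrable lborel {0<..<1} (\<lambda>t. of_real (t ^ k) * log_Gamma t)" (is ?integrable)
    and "(LBINT t:{0<..<1}. norm (of_real (t ^ k) * log_Gamma t)) \<le> 1 / (real k + 1)\<^sup>2" (is ?bound)
proof -
  have dominated: "norm (complex_of_real (t ^ k) * log_Gamma t) \<le> t ^ k * (- ln t)"
    if "0 < t" "t < 1" for t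
  proof -
    have "norm (complex_of_real (t ^ k) * log_Gamma t) = t ^ k * ln (Gamma t)"
      using that ln_Gamma_unit_interval_bounds(1)[of t]
      by (simp add: log_Gamma_def norm_mult norm_power)
    also have "\<dots> \<le> t ^ k * (- ln t)"
      using that ln_Gamma_unit_interval_bounds(2)[of t] by (intro mult_left_mono) auto
    finally show ?thesis .
  qed
  have "continuous_on {0<..<1} (\<lambda>t. complex_of_real (t ^ k) * log_Gamma t)"
    unfolding log_Gamma_def
    by (intro continuous_intros) (auto simp: Gamma_eq_zero_iff elim!: nonpos_Ints_cases')
  then have "set_borel_measurable lborel {0<..<1} (\<lambda>t. complex_of_real (t ^ k) * log_Gamma t)"
    unfolding set_borel_measurable_def
    by (simp add: borel_measurable_continuous_on_indicator)
  moreover have "norm (complex_of_real (t ^ k) * log_Gamma t) \<le> norm (t ^ k * (- ln t))"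
    if "t \<in> {0<..<1}" for t
    using that dominated[of t] abs_ge_self[of "t ^ k * (- ln t)"] unfolding real_norm_def by force
  ultimately show ?integrable
    by (intro set_integrable_bound[OF power_times_neg_ln_integral(1)[of k]] AE_I2 impI)
  then have "(LBINT t:{0<..<1}. norm (of_real (t ^ k) * log_Gamma t))
      \<le> (LBINT t:{0<..<1}. t ^ k * (- ln t))"
    using power_times_neg_ln_integral(1)[of k] dominated
    by (intro set_integral_mono set_integrable_norm) auto
  then show ?bound
    by (simp only: power_times_neg_ln_integral(2))
qed

section \<open>Termwise integration of the binomial series\<close>

text \<open>
  The coefficients are asymptotic to \<open>(-1) ^ n / (Gamma (- a) * n powr (a + 1))\<close>, and
  \<open>n powr (a + 1)\<close> has modulus at least 1 when \<open>Re a > -1\<close>.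
\<close>

lemma gbinomial_bounded:
  fixes a :: complex
  assumes "Re a > -1"
  obtains C where "C > 0" and "\<And>n. norm (a gchoose n) \<le> C"
proof -
  let ?q = "\<lambda>n. (a gchoose n) / ((-1) ^ n / exp ((a + 1) * of_real (ln (real n))))"
  have "Bseq ?q"
    using gbinomial_asymptotic[of a] by (intro convergent_imp_Bseq convergentI)
  then obtain C where C: "C > 0" "\<And>n. norm (?q n) \<le> C"
    by (auto elim: BseqE)
  have "norm (a gchoose n) \<le> C" for n
  proof -
    \<comment> \<open>For n = 0 this relies on the convention ln 0 = 0.\<close>
    have "0 \<le> (Re a + 1) * ln (real n)"
      using assms by (cases "n = 0") auto
    then have "norm (a gchoose n) * 1 \<le> norm (a gchoose n) * exp ((Re a + 1) * ln (real n))"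
      by (intro mult_left_mono) auto
    also have "\<dots> = norm (?q n)"
      by (simp add: norm_mult norm_divide norm_power)
    finally show ?thesis
      using C(2)[of n] by simp
  qed
  with C(1) show thesis
    by (rule that)
qed

text \<open>
  Termwise integration of the binomial series. Bounded coefficients suffice because the moments of
  \<open>log_Gamma\<close> decay quadratically; the singularity of \<open>(1 - t) powr a\<close> at 1 never has to be
  estimated, and integrability of the sum comes out of the same domination.
\<close>

lemma binomial_log_Gamma_series:
  fixes a :: complex and k :: nat
  assumes "Re a > -1"
  shows "set_integrable lborel {0<..<1}
           (\<lambda>t. of_real (t ^ k) * (of_real (1 - t) powr a * log_Gamma t))" (is ?integrable)
    and "(\<lambda>n. (-1) ^ n * (a gchoose n) * (LBINT t:{0<..<1}. of_real (t ^ (n + k)) * log_Gamma t))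
         sums (LBINT t:{0<..<1}. of_real (t ^ k) * (of_real (1 - t) powr a * log_Gamma t))" (is ?sums)
proof -
  obtain C where C: "C > 0" "\<And>n. norm (a gchoose n) \<le> C"
    using gbinomial_bounded[OF assms] by blast
  define c where "c n = (-1) ^ n * (a gchoose n)" for n
  have norm_c: "norm (c n) \<le> C" for n
    using C(2)[of n] by (simp add: c_def norm_mult norm_power)
  define f where "f n t = indicator {0<..<1} t *\<^sub>R (c n * (of_real (t ^ (n + k)) * log_Gamma t))"
    for n and t :: real
  have f_integrable: "integrable lborel (f n)" for n
    using set_integrable_mult_right[OF log_Gamma_moments(1)[of "n + k"], of "c n"]
    by (simp add: f_def[abs_def] set_integrable_def)
  have pointwise: "f n t = indicator {0<..<1} t *\<^sub>R
      ((a gchoose n) * (- of_real t) ^ n * (of_real (t ^ k) * log_Gamma t))" for n t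
    using power_minus[of "complex_of_real t" n]
    by (auto simp: f_def c_def power_add mult_ac split: split_indicator)
  have pointwise_sums: "(\<lambda>n. f n t) sums
      (indicator {0<..<1} t *\<^sub>R (of_real (t ^ k) * (of_real (1 - t) powr a * log_Gamma t)))" for t
  proof (cases "t \<in> {0<..<1}")
    case True
    then have "(\<lambda>n. (a gchoose n) * (- complex_of_real t) ^ n) sums (1 + (- of_real t)) powr a"
      by (intro gen_binomial_complex) auto
    then have "(\<lambda>n. (a gchoose n) * (- of_real t) ^ n * (of_real (t ^ k) * log_Gamma t)) sums
        ((1 + (- of_real t)) powr a * (of_real (t ^ k) * log_Gamma t))"
      by (rule sums_mult2)
    with True show ?thesis
      unfolding pointwise by (simp add: mult_ac)
  qed (simp add: f_def)
  have pointwise_summable: "summable (\<lambda>n. norm (f n t))" for t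
  proof (cases "t \<in> {0<..<1}")
    case True
    show ?thesis
    proof (rule summable_comparison_test'[where N = 0])
      show "summable (\<lambda>n. C * norm (of_real (t ^ k) * log_Gamma t) * t ^ n)"
        using True by (intro summable_mult summable_geometric) auto
      show "norm (norm (f n t)) \<le> C * norm (of_real (t ^ k) * log_Gamma t) * t ^ n" for n
        using mult_right_mono[OF C(2)[of n], of "norm (of_real (t ^ k) * log_Gamma t) * t ^ n"] True
        unfolding pointwise by (simp add: norm_mult norm_power mult_ac)
    qed
  qed (simp add: f_def)
  have norm_integral: "(LBINT t. norm (f n t)) \<le> C * (1 / (real (n + k) + 1)\<^sup>2)" for n
  proof -
    have "(LBINT t. norm (f n t)) = norm (c n) *
        (LBINT t:{0<..<1}. norm (of_real (t ^ (n + k)) * log_Gamma t))"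
      unfolding set_lebesgue_integral_def f_def integral_mult_right_zero[symmetric]
      by (intro Bochner_Integration.integral_cong) (auto simp: norm_mult split: split_indicator)
    also have "\<dots> \<le> C * (1 / (real (n + k) + 1)\<^sup>2)"
      using log_Gamma_moments(2)[of "n + k"] norm_c[of n] C(1)
      by (intro mult_mono) (auto simp: set_lebesgue_integral_def intro!: integral_nonneg)
    finally show ?thesis .
  qed
  have "summable (\<lambda>n. 1 / (real n)\<^sup>2)"
    using inverse_power_summable[of 2, where ?'a = real] by (simp add: inverse_eq_divide)
  then have "summable (\<lambda>n. 1 / (real (n + (k + 1)))\<^sup>2)"
    by (rule summable_ignore_initial_segment)
  then have "summable (\<lambda>n. C * (1 / (real (n + k) + 1)\<^sup>2))"
    by (intro summable_mult) (simp add: add_ac)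
  then have summable: "summable (\<lambda>n. LBINT t. norm (f n t))"
    by (rule summable_comparison_test'[where N = 0]) (use norm_integral in auto)
  have suminf: "(\<Sum>n. f n t) = indicator {0<..<1} t *\<^sub>R
      (of_real (t ^ k) * (of_real (1 - t) powr a * log_Gamma t))" for t
    using pointwise_sums by (rule sums_unique[symmetric])
  note swap = f_integrable AE_I2[OF pointwise_summable] summable
  show ?integrable
    using integrable_suminf[OF swap] by (simp add: suminf set_integrable_def)
  have "integral\<^sup>L lborel (f n) =
      c n * (LBINT t:{0<..<1}. of_real (t ^ (n + k)) * log_Gamma t)" for n
    by (simp add: f_def[abs_def] set_lebesgue_integral_def flip: integral_mult_right_zero)
  then show ?sums
    using sums_integral[OF swap] by (simp add: suminf set_lebesgue_integral_def c_def)
qed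

section \<open>Repeated integration\<close>

lemma has_bochner_integral_power_diff:
  fixes x s :: real
  assumes "x \<le> s"
  shows "has_bochner_integral lborel (\<lambda>t. indicator {x<..<s} t * (s - t) ^ k)
           ((s - x) ^ Suc k / real (Suc k))"
proof -
  have "has_bochner_integral lborel (\<lambda>t. (s - t) ^ k * indicator {x..s} t)
      (- ((s - s) ^ Suc k / real (Suc k)) - (- ((s - x) ^ Suc k / real (Suc k))))"
    using assms
    by (intro has_bochner_integral_FTC_Icc_real)
      (auto intro!: derivative_eq_intros continuous_intros simp del: power_Suc)
  moreover have "AE t in lborel. (s - t) ^ k * indicator {x..s} t = indicator {x<..<s} t * (s - t) ^ k"
    using AE_lborel_singleton[of x] AE_lborel_singleton[of s]
    by eventually_elim (auto split: split_indicator)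
  ultimately show ?thesis
    by (subst has_bochner_integral_cong_AE[symmetric]) auto
qed

text \<open>
  Cauchy's formula for repeated integration. In the inductive step the integral over
  \<open>x < t < s < b\<close> is taken first in \<open>t\<close>, where the kernel \<open>(s - t) ^ k / k!\<close> integrates to
  \<open>(s - x) ^ (k + 1) / (k + 1)!\<close>. Since \<open>f\<close> may be unbounded at both endpoints, the exchange rests
  on Fubini's theorem; the kernel is bounded on the triangle, so integrability of \<open>f\<close> is enough.
\<close>

lemma iterated_integral_eq_Cauchy_kernel:
  fixes f :: "real \<Rightarrow> complex"
  assumes "set_integrable lborel {x<..<b} f"
  shows "iterated_integral b f (Suc k) x = (LBINT t:{x<..<b}. of_real ((t - x) ^ k / fact k) * f t)"
  using assms
proof (induction k arbitrary: x)
  case 0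
  then show ?case by simp
next
  case (Suc k)
  have f_integrable: "integrable lborel (\<lambda>s. indicator {x<..<b} s *\<^sub>R f s)"
    using Suc.prems by (simp add: set_integrable_def)
  note [measurable] = borel_measurable_integrable[OF f_integrable]
  define g where "g s t = (indicator {x<..<s} t * (s - t) ^ k / fact k) *\<^sub>R (indicator {x<..<b} s *\<^sub>R f s)"
    for s t
  define F where "F = (\<lambda>(s, t). g s t)"
  have kernel: "has_bochner_integral lborel (\<lambda>t. indicator {x<..<s} t * (s - t) ^ k / fact k)
      ((s - x) ^ Suc k / fact (Suc k))" if "s \<in> {x<..<b}" for s
    using has_bochner_integral_divide_zero[OF has_bochner_integral_power_diff[of x s k], of "fact k"] that
    by (simp add: mult_ac)
  have g_integral: "(LBINT t. g s t) = ((s - x) ^ Suc k / fact (Suc k)) *\<^sub>R (indicator {x<..<b} s *\<^sub>R f s)"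
    for s
  proof (cases "s \<in> {x<..<b}")
    case True
    show ?thesis
      unfolding g_def
      by (intro has_bochner_integral_integral_eq has_bochner_integral_scaleR_left kernel[OF True])
  qed (simp add: g_def)
  have "integrable (lborel \<Otimes>\<^sub>M lborel) F"
  proof (rule lborel_pair.Fubini_integrable)
    have "{p \<in> space (lborel \<Otimes>\<^sub>M lborel). x < snd p \<and> snd p < fst p} \<in> sets (lborel \<Otimes>\<^sub>M lborel)"
      by measurable
    then have [measurable]: "{p :: real \<times> real. x < snd p \<and> snd p < fst p} \<in> sets (lborel \<Otimes>\<^sub>M lborel)"
      by (simp add: space_pair_measure)
    have F_eq: "F = (\<lambda>p. (indicator {p :: real \<times> real. x < snd p \<and> snd p < fst p} p
        * (fst p - snd p) ^ k / fact k) *\<^sub>R (indicator {x<..<b} (fst p) *\<^sub>R f (fst p)))"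
      by (auto simp: F_def g_def fun_eq_iff split: split_indicator)
    show "F \<in> borel_measurable (lborel \<Otimes>\<^sub>M lborel)"
      unfolding F_eq by measurable
    show "AE s in lborel. integrable lborel (\<lambda>t. F (s, t))"
    proof (rule AE_I2)
      fix s
      show "integrable lborel (\<lambda>t. F (s, t))"
      proof (cases "s \<in> {x<..<b}")
        case True
        show ?thesis
          unfolding F_def prod.case g_def
          by (intro integrable_scaleR_left integrable.intros[OF kernel[OF True]])
      qed (simp add: F_def g_def)
    qed
    have "(LBINT t. norm (F (s, t))) =
        (indicator {x<..<b} s * (s - x) ^ Suc k / fact (Suc k)) * norm (indicator {x<..<b} s *\<^sub>R f s)" for s
    proof (cases "s \<in> {x<..<b}")
      case True
      have "(LBINT t. norm (F (s, t))) = (LBINT t.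
          (indicator {x<..<s} t * (s - t) ^ k / fact k) * norm (indicator {x<..<b} s *\<^sub>R f s))"
        by (intro Bochner_Integration.integral_cong)
          (auto simp: F_def g_def norm_mult split: split_indicator)
      also have "\<dots> = (s - x) ^ Suc k / fact (Suc k) * norm (indicator {x<..<b} s *\<^sub>R f s)"
        using has_bochner_integral_mult_left[OF kernel[OF True]]
        by (intro has_bochner_integral_integral_eq) simp
      finally show ?thesis
        using True by simp
    qed (simp add: F_def g_def)
    moreover have "integrable lborel (\<lambda>s. (indicator {x<..<b} s * (s - x) ^ Suc k / fact (Suc k))
        * norm (indicator {x<..<b} s *\<^sub>R f s))"
    proof (rule Bochner_Integration.integrable_bound)
      show "integrable lborel (\<lambda>s. ((b - x) ^ Suc k / fact (Suc k)) *
          norm (indicator {x<..<b} s *\<^sub>R f s))"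
        using f_integrable by (intro integrable_mult_right integrable_norm)
      show "AE s in lborel. norm (indicator {x<..<b} s * (s - x) ^ Suc k / fact (Suc k)
          * norm (indicator {x<..<b} s *\<^sub>R f s))
          \<le> norm ((b - x) ^ Suc k / fact (Suc k) * norm (indicator {x<..<b} s *\<^sub>R f s))"
        by (intro AE_I2) (auto simp: abs_mult split: split_indicator
            intro!: mult_right_mono divide_right_mono mult_mono power_mono simp del: fact_Suc)
    qed measurable
    ultimately show "integrable lborel (\<lambda>s. LBINT t. norm (F (s, t)))"
      by simp
  qed
  then have swap: "(LBINT t. LBINT s. g s t) = (LBINT s. LBINT t. g s t)"
    unfolding F_def by (rule lborel_pair.Fubini_integral)
  have inner: "indicator {x<..<b} t *\<^sub>R iterated_integral b f (Suc k) t = (LBINT s. g s t)" for t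
  proof (cases "t \<in> {x<..<b}")
    case True
    have "set_integrable lborel {t<..<b} f"
      using True by (intro set_integrable_subset[OF Suc.prems]) auto
    then have "iterated_integral b f (Suc k) t = (LBINT s:{t<..<b}. of_real ((s - t) ^ k / fact k) * f s)"
      by (rule Suc.IH)
    also have "\<dots> = (LBINT s. g s t)"
      unfolding set_lebesgue_integral_def using True
      by (intro Bochner_Integration.integral_cong)
        (auto simp: g_def scaleR_conv_of_real split: split_indicator)
    finally show ?thesis
      using True by simp
  next
    case False
    then have "g s t = 0" for s
      by (auto simp: g_def split: split_indicator)
    with False show ?thesis
      by simp
  qed
  have "iterated_integral b f (Suc (Suc k)) x =
      (LBINT t:{x<..<b}. iterated_integral b f (Suc k) t)"
    by (rule iterated_integral.simps)
  also have "\<dots> = (LBINT t. LBINT s. g s t)"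
    by (simp only: set_lebesgue_integral_def inner)
  also have "\<dots> = (LBINT s:{x<..<b}. of_real ((s - x) ^ Suc k / fact (Suc k)) * f s)"
    unfolding swap g_integral set_lebesgue_integral_def
    by (simp add: scaleR_conv_of_real mult_ac)
  finally show ?case .
qed

lemma rl_right_integral_of_nat:
  "rl_right_integral b (of_nat (Suc k)) f x = (LBINT t:{x<..<b}. of_real ((t - x) ^ k) * f t) / fact k"
proof -
  have "Gamma (of_nat (Suc k)) = (fact k :: complex)"
    using Gamma_fact[of k, where ?'a = complex] by simp
  moreover have "(LBINT t:{x<..<b}. of_real (t - x) powr (of_nat (Suc k) - 1) * f t) =
      (LBINT t:{x<..<b}. of_real ((t - x) ^ k) * f t)"
    by (intro set_lebesgue_integral_cong) (auto simp: powr_nat')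
  ultimately show ?thesis
    by (simp add: rl_right_integral_def)
qed

section \<open>The series for the repeated integral\<close>

theorem corollary4p1:
  fixes m :: nat and \<beta> :: complex
  assumes "m \<ge> 1" and "Re \<beta> > 0"
  shows "rl_right_integral 1 (of_nat m) (\<lambda>x. of_real (1 - x) powr (\<beta> - 1) * log_Gamma x) 0
           = iterated_integral 1 (\<lambda>t. of_real (1 - t) powr (\<beta> - 1) * log_Gamma t) m 0
       \<and> (\<lambda>n. (-1) ^ n * of_nat (\<Prod>{m..<m + n}) * ((\<beta> - 1) gchoose n)
               * rl_right_integral 1 (of_nat (n + m)) log_Gamma 0)
         sums iterated_integral 1 (\<lambda>t. of_real (1 - t) powr (\<beta> - 1) * log_Gamma t) m 0"
proof -
  obtain k where m: "m = Suc k"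
    using assms(1) by (cases m) auto
  let ?f = "\<lambda>t. of_real (1 - t) powr (\<beta> - 1) * log_Gamma t"
  let ?I = "LBINT t:{0<..<1}. of_real (t ^ k) * ?f t"
  have "Re (\<beta> - 1) > -1"
    using assms(2) by simp
  note series = binomial_log_Gamma_series[OF this]
  have "set_integrable lborel {0<..<1} ?f"
    using series(1)[of 0] by simp
  then have "iterated_integral 1 ?f m 0 = (LBINT t:{0<..<1}. of_real ((t - 0) ^ k / fact k) * ?f t)"
    unfolding m by (rule iterated_integral_eq_Cauchy_kernel)
  also have "\<dots> = ?I / fact k"
    by (simp add: set_lebesgue_integral_def flip: integral_divide_zero)
  finally have iterated: "iterated_integral 1 ?f m 0 = ?I / fact k" .
  have term_eq: "(-1) ^ n * of_nat (\<Prod>{m..<m + n}) * ((\<beta> - 1) gchoose n)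
        * rl_right_integral 1 (of_nat (n + m)) log_Gamma 0 =
      (-1) ^ n * ((\<beta> - 1) gchoose n) * (LBINT t:{0<..<1}. of_real (t ^ (n + k)) * log_Gamma t) / fact k"
    for n
  proof -
    have "fact k * \<Prod>{m..<m + n} = (fact (n + k) :: nat)"
      unfolding m by (induction n) (auto simp: algebra_simps prod.atLeastLessThan_Suc)
    then have "fact k * of_nat (\<Prod>{m..<m + n}) = (fact (n + k) :: complex)"
      by (metis of_nat_fact of_nat_mult)
    then have "of_nat (\<Prod>{m..<m + n}) = (fact (n + k) / fact k :: complex)"
      by (simp add: field_simps)
    then show ?thesis
      using rl_right_integral_of_nat[of 1 "n + k" log_Gamma 0] by (simp add: m)
  qed
  have "rl_right_integral 1 (of_nat m) ?f 0 = iterated_integral 1 ?f m 0"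
    unfolding iterated unfolding m rl_right_integral_of_nat by simp
  moreover have "(\<lambda>n. (-1) ^ n * of_nat (\<Prod>{m..<m + n}) * ((\<beta> - 1) gchoose n)
      * rl_right_integral 1 (of_nat (n + m)) log_Gamma 0) sums iterated_integral 1 ?f m 0"
    unfolding term_eq iterated by (intro sums_divide series(2))
  ultimately show ?thesis ..
qed

end
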